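(* Let $n\in\{2,3\}$ and let $m\ge 2$ be an integer. Then $$\gamma_{rdR}(P_n\boxtimes P_m)=\begin{cases} m, & m\equiv 0 \pmod 3,\\ m+2, & m\equiv 1 \pmod 3,\\ m+1, & m\equiv 2 \pmod 3.\end{cases}$$
   Context: Graphs are finite and simple. A restrained double Roman dominating function (RDRD-function) of a graph $G$ is a function $f:V(G)\to\{0,1,2,3\}$ such that: (i) if $f(v)=0$, then $v$ has at least two neighbours assigned 2 under $f$ or at least one neighbour assigned 3; (ii) if $f(v)=1$, then $v$ has a neighbour $u$ with $f(u)\ge 2$; (iii) the subgraph of $G$ induced by the vertices assigned 0 contains no isolated vertex. The weight of $f$ is $\sum_{v\in V(G)}f(v)$, and $\gamma_{rdR}(G)$ is the minimum weight of an RDRD-function of $G$. $P_n$ is the path on $n$ vertices. The strong product $G\boxtimes H$ has vertex set $V(G)\times V(H)$, with $(u,v)(u',v')$ an edge iff ($uu'\in E(G)$ and $v=v'$), or ($u=u'$ and $vv'\in E(H)$), or ($uu'\in E(G)$ and $vv'\in E(H)$). *)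

theory Defs
  imports "Graph_Theory.Graph_Theory"
begin

text \<open>
  A finite simple graph is a \<open>pair_graph\<close> in the sense of \<open>Graph_Theory\<close>: a finite,
  loop-free, symmetric digraph in which every undirected edge is represented by its two arcs.
\<close>

definition path_graph :: "nat \<Rightarrow> nat pair_pre_digraph" where
  "path_graph n = \<lparr> pverts = {1..n},
     parcs = {(i, j). i \<in> {1..n} \<and> j \<in> {1..n} \<and> (j = i + 1 \<or> i = j + 1)} \<rparr>"

definition strong_product ::
  "'a pair_pre_digraph \<Rightarrow> 'b pair_pre_digraph \<Rightarrow> ('a \<times> 'b) pair_pre_digraph"
  (infixr \<open>\<boxtimes>\<close> 70) where
  "G \<boxtimes> H = \<lparr> pverts = pverts G \<times> pverts H,
     parcs = {((u, v), (u', v')).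
       ((u, u') \<in> parcs G \<and> v = v' \<and> v \<in> pverts H) \<or>
       (u = u' \<and> u \<in> pverts G \<and> (v, v') \<in> parcs H) \<or>
       ((u, u') \<in> parcs G \<and> (v, v') \<in> parcs H)} \<rparr>"

definition isolated_vertex :: "('a, 'b) pre_digraph \<Rightarrow> 'a \<Rightarrow> bool" where
  "isolated_vertex G v \<longleftrightarrow> v \<in> verts G \<and> \<not> (\<exists>u. v \<rightarrow>\<^bsub>G\<^esub> u)"

text \<open>Values of \<open>f\<close> outside the vertex set are irrelevant.\<close>

definition rdrd_function :: "'a pair_pre_digraph \<Rightarrow> ('a \<Rightarrow> nat) \<Rightarrow> bool" where
  "rdrd_function G f \<longleftrightarrow>
     (\<forall>v \<in> pverts G. f v \<in> {0, 1, 2, 3}) \<and>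
     (\<forall>v \<in> pverts G. f v = 0 \<longrightarrow>
        (\<exists>u w. u \<noteq> w \<and> v \<rightarrow>\<^bsub>G\<^esub> u \<and> v \<rightarrow>\<^bsub>G\<^esub> w \<and> f u = 2 \<and> f w = 2) \<or>
        (\<exists>u. v \<rightarrow>\<^bsub>G\<^esub> u \<and> f u = 3)) \<and>
     (\<forall>v \<in> pverts G. f v = 1 \<longrightarrow> (\<exists>u. v \<rightarrow>\<^bsub>G\<^esub> u \<and> f u \<ge> 2)) \<and>
     \<not> (\<exists>v. isolated_vertex (with_proj G \<restriction> {w \<in> pverts G. f w = 0}) v)"

definition weight :: "'a pair_pre_digraph \<Rightarrow> ('a \<Rightarrow> nat) \<Rightarrow> nat" where
  "weight G f = (\<Sum>v \<in> pverts G. f v)"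

definition gamma_rdR :: "'a pair_pre_digraph \<Rightarrow> nat" (\<open>\<gamma>\<^sub>r\<^sub>d\<^sub>R\<close>) where
  "gamma_rdR G = (LEAST k. \<exists>f. rdrd_function G f \<and> weight G f = k)"

lemma pair_graph_path_graph: "pair_graph (path_graph n)"
proof -
  have "parcs (path_graph n) \<subseteq> {1..n} \<times> {1..n}"
    by (auto simp: path_graph_def)
  then have "finite (parcs (path_graph n))"
    by (rule finite_subset) simp
  then show ?thesis
    by unfold_locales (auto simp: path_graph_def symmetric_def sym_def)
qed

lemma pair_graph_strong_product:
  assumes "pair_graph G" "pair_graph H"
  shows "pair_graph (G \<boxtimes> H)"
proof -
  interpret G: pair_graph G by fact
  interpret H: pair_graph H by fact
  have fin: "finite (pverts (G \<boxtimes> H))"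
    by (simp add: strong_product_def)
  have sub: "parcs (G \<boxtimes> H) \<subseteq> pverts (G \<boxtimes> H) \<times> pverts (G \<boxtimes> H)"
    by (auto simp: strong_product_def dest: G.in_arcsD1 G.in_arcsD2 H.in_arcsD1 H.in_arcsD2)
  then have "finite (parcs (G \<boxtimes> H))"
    by (rule finite_subset) (simp add: fin)
  note fin_arcs = this
  have symG: "(u', u) \<in> parcs G" if "(u, u') \<in> parcs G" for u u'
    using G.sym_arcs that by (auto simp: symmetric_def dest: symD)
  have symH: "(v', v) \<in> parcs H" if "(v, v') \<in> parcs H" for v v'
    using H.sym_arcs that by (auto simp: symmetric_def dest: symD)
  show ?thesis
  proof unfold_locales
    show "finite (pverts (G \<boxtimes> H))" "finite (parcs (G \<boxtimes> H))"
      by (fact fin fin_arcs)+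
    show "symmetric (with_proj (G \<boxtimes> H))"
      unfolding symmetric_def
      by (rule symI) (auto simp: strong_product_def intro: symG symH)
    fix e assume e: "e \<in> parcs (G \<boxtimes> H)"
    show "fst e \<in> pverts (G \<boxtimes> H)" "snd e \<in> pverts (G \<boxtimes> H)"
      using sub e by auto
    show "fst e \<noteq> snd e"
      using e G.pair_no_loops H.pair_no_loops by (fastforce simp: strong_product_def)
  qed
qed

text \<open>The constant function 2 is an RDRD-function, so the minimum is always attained.\<close>

lemma rdrd_function_const_2: "rdrd_function G (\<lambda>_. 2)"
  by (simp add: rdrd_function_def isolated_vertex_def)

lemma gamma_rdR_attained: "\<exists>f. rdrd_function G f \<and> weight G f = \<gamma>\<^sub>r\<^sub>d\<^sub>R G"
  unfolding gamma_rdR_def by (rule LeastI_ex) (use rdrd_function_const_2 in blast)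

lemma gamma_rdR_le: "rdrd_function G f \<Longrightarrow> \<gamma>\<^sub>r\<^sub>d\<^sub>R G \<le> weight G f"
  unfolding gamma_rdR_def by (rule Least_le) blast

end

theory Submission
  imports Defs
begin

text \<open>
  Columns are the copies of \<open>P\<^sub>n\<close> inside \<open>P\<^sub>n \<boxtimes> P\<^sub>m\<close>. Because \<open>n \<in> {2, 3}\<close>, every vertex of the second
  row is adjacent to all other vertices of its own column and of the (at most two) neighbouring
  columns, so as far as domination is concerned the grid behaves like the path \<open>P\<^sub>m\<close> of its columns.
  Every path has a perfect code: a set \<open>D\<close> of columns such that each column lies within distance one
  of exactly one member of \<open>D\<close>. It has \<open>\<lceil>m / 3\<rceil>\<close> elements, and \<open>3 * \<lceil>m / 3\<rceil>\<close> is the value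
  claimed in each of the three residue classes.

  Such a code gives both bounds. Assigning 3 to the second-row vertices in the columns of \<open>D\<close> and 0
  elsewhere is an RDRD-function of weight \<open>3 * |D|\<close>: all vertices are dominated, and since the other
  rows carry only zeros and \<open>m \<ge> 2\<close>, no zero is isolated among the zeros
  (\<open>rdrd_function_code\<close>). Conversely, any RDRD-function has weight at least 3 on a column together
  with its neighbouring columns (\<open>column_block_weight_ge_3\<close>), and the blocks around the members of
  \<open>D\<close> partition the grid, so the weight is at least \<open>3 * |D|\<close>.
\<close>

section \<open>Adjacency in strong products of paths\<close>

lemma grid_adj_iff:
  "((i, j), (i', j')) \<in> parcs (path_graph n \<boxtimes> path_graph m) \<longleftrightarrow>
     i \<in> {1..n} \<and> i' \<in> {1..n} \<and> j \<in> {1..m} \<and> j' \<in> {1..m} \<and> (i, j) \<noteq> (i', j') \<and>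
     i \<le> i' + 1 \<and> i' \<le> i + 1 \<and> j \<le> j' + 1 \<and> j' \<le> j + 1"
proof -
  have *: "(i, i') \<in> parcs (path_graph k) \<longleftrightarrow>
      i \<in> {1..k} \<and> i' \<in> {1..k} \<and> i \<noteq> i' \<and> i \<le> i' + 1 \<and> i' \<le> i + 1" for i i' k
    by (auto simp: path_graph_def)
  have "pverts (path_graph k) = {1..k}" for k
    by (simp add: path_graph_def)
  then show ?thesis
    by (auto simp: strong_product_def *)
qed

lemma pverts_grid: "pverts (path_graph n \<boxtimes> path_graph m) = {1..n} \<times> {1..m}"
  by (simp add: strong_product_def path_graph_def)

lemma no_isolated_vertex_induce_iff:
  "\<not> (\<exists>v. isolated_vertex (with_proj G \<restriction> {w \<in> pverts G. f w = 0}) v) \<longleftrightarrow>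
     (\<forall>v \<in> pverts G. f v = 0 \<longrightarrow> (\<exists>u \<in> pverts G. f u = 0 \<and> v \<rightarrow>\<^bsub>with_proj G\<^esub> u))"
  by (auto simp: isolated_vertex_def induce_subgraph_def arcs_ends_def arc_to_ends_def)

section \<open>A perfect code of the path\<close>

text \<open>
  The members lie three apart. Starting at 1 when \<open>m mod 3 = 1\<close>, and at 2 otherwise, keeps the last
  member within \<open>{1..m}\<close> and leaves at most one column after it.
\<close>

definition path_code :: "nat \<Rightarrow> nat set" where
  "path_code m = (\<lambda>k. 3 * k + (if m mod 3 = 1 then 1 else 2)) ` {..<(m + 2) div 3}"

definition column_block :: "nat \<Rightarrow> nat \<Rightarrow> nat set" where
  "column_block m j = {j' \<in> {1..m}. j \<le> j' + 1 \<and> j' \<le> j + 1}"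

lemma finite_column_block [simp]: "finite (column_block m j)"
  by (simp add: column_block_def)

lemma finite_path_code [simp]: "finite (path_code m)"
  by (simp add: path_code_def)

lemma card_path_code:
  "3 * card (path_code m) = (if m mod 3 = 0 then m else if m mod 3 = 1 then m + 2 else m + 1)"
proof -
  have "card (path_code m) = (m + 2) div 3"
    unfolding path_code_def by (subst card_image) (auto simp: inj_on_def)
  moreover have "m mod 3 = 0 \<Longrightarrow> 3 * ((m + 2) div 3) = m"
      "m mod 3 = 1 \<Longrightarrow> 3 * ((m + 2) div 3) = m + 2"
      "m mod 3 = 2 \<Longrightarrow> 3 * ((m + 2) div 3) = m + 1"
    by presburger+
  moreover consider "m mod 3 = 0" | "m mod 3 = 1" | "m mod 3 = 2"
    by linarith
  ultimately show ?thesis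
    by cases simp_all
qed

lemma path_code_iff:
  "d \<in> path_code m \<longleftrightarrow> d \<in> {1..m} \<and> d mod 3 = (if m mod 3 = 1 then 1 else 2)"
proof -
  define r :: nat where "r = (if m mod 3 = 1 then 1 else 2)"
  have r: "0 < r" "r < 3"
    by (simp_all add: r_def)
  have bound: "k < (m + 2) div 3 \<longleftrightarrow> 3 * k + r \<le> m" for k
  proof -
    have "k < (m + 2) div 3 \<longleftrightarrow> 3 * k + 1 \<le> m"
      by (auto simp: less_eq_div_iff_mult_less_eq simp flip: Suc_le_eq)
    also have "\<dots> \<longleftrightarrow> 3 * k + r \<le> m"
    proof
      assume "3 * k + 1 \<le> m"
      moreover have "m \<noteq> 3 * k + 1" if "m mod 3 \<noteq> 1"
        using that by auto
      ultimately show "3 * k + r \<le> m"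
        unfolding r_def by (cases "m mod 3 = 1") auto
    qed (use r in simp)
    finally show ?thesis .
  qed
  have "d \<in> path_code m \<longleftrightarrow> (\<exists>k. k < (m + 2) div 3 \<and> d = 3 * k + r)"
    by (auto simp: path_code_def r_def)
  also have "\<dots> \<longleftrightarrow> (\<exists>k. d = 3 * k + r) \<and> d \<le> m"
    using bound by auto
  also have "(\<exists>k. d = 3 * k + r) \<longleftrightarrow> 1 \<le> d \<and> d mod 3 = r"
  proof
    assume "1 \<le> d \<and> d mod 3 = r"
    then have "d = 3 * (d div 3) + r"
      by (metis mult_div_mod_eq)
    then show "\<exists>k. d = 3 * k + r" ..
  qed (use r in auto)
  finally show ?thesis
    by (auto simp: r_def)
qed

lemma path_code_dominates:
  assumes "j \<in> {1..m}"
  obtains d where "d \<in> path_code m" "j \<le> d + 1" "d \<le> j + 1"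
proof -
  have up: "(j + 1) mod 3 = (if j mod 3 = 2 then 0 else j mod 3 + 1)"
    by (simp add: mod_Suc)
  have down: "(j - 1) mod 3 = (if j mod 3 = 0 then 2 else j mod 3 - 1)"
    using assms by (cases j) (auto simp: mod_Suc)
  \<comment> \<open>A member just after \<open>j\<close> is at most \<open>m\<close>, as \<open>j\<close> and \<open>m\<close> then have different residues;
      likewise a member just before \<open>j\<close> is positive, as \<open>j \<noteq> 1\<close>.\<close>
  have above: "j + 1 \<le> m" if "j mod 3 \<noteq> m mod 3"
    using that assms by (cases "j = m") auto
  have below: "2 \<le> j" if "j mod 3 \<noteq> 1"
    using that assms by (cases "j = 1") auto
  consider "j mod 3 = 0" | "j mod 3 = 1" | "j mod 3 = 2"
    by linarith
  then have "j - 1 \<in> path_code m \<or> j \<in> path_code m \<or> j + 1 \<in> path_code m"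
  proof cases
    case 1
    with assms up down above below show ?thesis
      by (cases "m mod 3 = 1") (auto simp: path_code_iff)
  next
    case 2
    with assms up above show ?thesis
      by (cases "m mod 3 = 1") (auto simp: path_code_iff)
  next
    case 3
    with assms down below show ?thesis
      by (cases "m mod 3 = 1") (auto simp: path_code_iff)
  qed
  then show thesis
    using that by fastforce
qed

lemma path_code_blocks_cover: "(\<Union>d \<in> path_code m. column_block m d) = {1..m}"
proof
  show "{1..m} \<subseteq> (\<Union>d \<in> path_code m. column_block m d)"
  proof
    fix j assume j: "j \<in> {1..m}"
    then obtain d where "d \<in> path_code m" "j \<le> d + 1" "d \<le> j + 1"
      by (rule path_code_dominates)
    with j show "j \<in> (\<Union>d \<in> path_code m. column_block m d)"
      by (auto simp: column_block_def)
  qed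
qed (auto simp: column_block_def)

lemma path_code_blocks_disjoint:
  assumes "d \<in> path_code m" "e \<in> path_code m" "d \<noteq> e"
  shows "column_block m d \<inter> column_block m e = {}"
proof -
  have "d mod 3 = e mod 3"
    using assms by (simp add: path_code_iff)
  with \<open>d \<noteq> e\<close> have "d + 3 \<le> e \<or> e + 3 \<le> d"
    by presburger
  then show ?thesis
    by (auto simp: column_block_def)
qed

section \<open>The lower bound\<close>

text \<open>
  A vertex of value 0 sees a 3 or two 2s, and one of value 1 sees another vertex of value at
  least 2. Vertices of value 2 are the exception: their closed neighbourhood may have weight only 2.
\<close>

lemma closed_neighbourhood_weight_ge_3:
  fixes f :: "'a \<Rightarrow> nat"
  assumes f: "rdrd_function G f" and v: "v \<in> pverts G" "f v \<le> 1"
    and T: "finite T" "v \<in> T" "\<And>u. v \<rightarrow>\<^bsub>with_proj G\<^esub> u \<Longrightarrow> u \<in> T"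
  shows "3 \<le> sum f T"
proof -
  have pair: "f x + f y \<le> sum f T" if "x \<in> T" "y \<in> T" "x \<noteq> y" for x y
    using sum_mono2[of T "{x, y}" f] T(1) that by simp
  consider "f v = 0" | "f v = 1"
    using v(2) by linarith
  then show ?thesis
  proof cases
    case 1
    with f v(1) consider
        (two_twos) u w where "u \<noteq> w" "v \<rightarrow>\<^bsub>with_proj G\<^esub> u" "v \<rightarrow>\<^bsub>with_proj G\<^esub> w" "f u = 2" "f w = 2"
      | (three) u where "v \<rightarrow>\<^bsub>with_proj G\<^esub> u" "f u = 3"
      unfolding rdrd_function_def by blast
    then show ?thesis
    proof cases
      case two_twos
      then show ?thesis using pair[of u w] T(3) by simp
    next
      case three
      then show ?thesis using member_le_sum[of u T f] T by simp
    qed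
  next
    case 2
    with f v(1) obtain u where u: "v \<rightarrow>\<^bsub>with_proj G\<^esub> u" "f u \<ge> 2"
      unfolding rdrd_function_def by blast
    with 2 have "u \<noteq> v" by auto
    with u 2 show ?thesis using pair[of u v] T by simp
  qed
qed

text \<open>
  The block is the closed neighbourhood of \<open>(2, j)\<close>, and it also contains that of \<open>(1, j)\<close>. So the
  exceptional value 2 at \<open>(2, j)\<close> is harmless: either \<open>(1, j)\<close> has positive value, which raises the
  weight to 3, or it has value 0 and itself forces weight 3.
\<close>

lemma column_block_weight_ge_3:
  assumes n: "n \<in> {2, 3}" and j: "j \<in> {1..m}"
    and f: "rdrd_function (path_graph n \<boxtimes> path_graph m) f"
  shows "3 \<le> (\<Sum>v \<in> {1..n} \<times> column_block m j. f v)"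
proof -
  let ?G = "path_graph n \<boxtimes> path_graph m" and ?T = "{1..n} \<times> column_block m j"
  have verts: "(i, j) \<in> pverts ?G" and mem: "(i, j) \<in> ?T" if "i \<in> {1, 2}" for i
    using n j that by (auto simp: pverts_grid column_block_def)
  have nbrs: "u \<in> ?T" if "(i, j) \<rightarrow>\<^bsub>with_proj ?G\<^esub> u" for i u
    using that by (cases u) (auto simp: grid_adj_iff column_block_def)
  have light: "3 \<le> sum f ?T" if "i \<in> {1, 2}" "f (i, j) \<le> 1" for i
    using closed_neighbourhood_weight_ge_3[OF f verts _ _ mem nbrs] that by simp
  have "f (1, j) + f (2, j) \<le> sum f ?T"
    using sum_mono2[of ?T "{(1, j), (2, j)}" f] mem[of 1] mem[of 2] by simp
  with light[of 1] light[of 2] show ?thesis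
    by fastforce
qed

lemma rdrd_weight_ge_code:
  assumes "n \<in> {2, 3}" and f: "rdrd_function (path_graph n \<boxtimes> path_graph m) f"
  shows "3 * card (path_code m) \<le> weight (path_graph n \<boxtimes> path_graph m) f"
proof -
  have "3 * card (path_code m) = (\<Sum>d \<in> path_code m. 3)"
    by simp
  also have "\<dots> \<le> (\<Sum>d \<in> path_code m. \<Sum>v \<in> {1..n} \<times> column_block m d. f v)"
    using assms by (intro sum_mono column_block_weight_ge_3) (auto simp: path_code_iff)
  also have "\<dots> = (\<Sum>v \<in> (\<Union>d \<in> path_code m. {1..n} \<times> column_block m d). f v)"
    by (rule sum.UNION_disjoint[symmetric]) (use path_code_blocks_disjoint in auto)
  also have "(\<Union>d \<in> path_code m. {1..n} \<times> column_block m d) = {1..n} \<times> {1..m}"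
    using path_code_blocks_cover[of m] by blast
  finally show ?thesis
    by (simp add: weight_def pverts_grid)
qed

section \<open>The upper bound\<close>

definition code_function :: "nat \<Rightarrow> nat \<times> nat \<Rightarrow> nat" where
  "code_function m v = (if v \<in> {2} \<times> path_code m then 3 else 0)"

lemma rdrd_function_code:
  assumes n: "n \<in> {2, 3}" and m: "m \<ge> 2"
  shows "rdrd_function (path_graph n \<boxtimes> path_graph m) (code_function m)"
  unfolding rdrd_function_def no_isolated_vertex_induce_iff
proof (intro conjI ballI impI)
  let ?G = "path_graph n \<boxtimes> path_graph m"
  fix v assume "v \<in> pverts ?G" and zero: "code_function m v = 0"
  then obtain i j where v: "v = (i, j)" and i: "i \<in> {1..n}" and j: "j \<in> {1..m}"
    by (auto simp: pverts_grid)
  obtain d where d: "d \<in> path_code m" "j \<le> d + 1" "d \<le> j + 1"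
    using j by (rule path_code_dominates)
  then have three: "code_function m (2, d) = 3"
    by (simp add: code_function_def)
  with zero v have "(i, j) \<noteq> (2, d)"
    by auto
  moreover have "d \<in> {1..m}"
    using d(1) by (simp add: path_code_iff)
  moreover have "i \<le> 3" "2 \<le> n"
    using n i by auto
  ultimately have "v \<rightarrow>\<^bsub>with_proj ?G\<^esub> (2, d)"
    using i j d(2,3) by (simp add: v grid_adj_iff)
  with three show "(\<exists>u w. u \<noteq> w \<and> v \<rightarrow>\<^bsub>with_proj ?G\<^esub> u \<and> v \<rightarrow>\<^bsub>with_proj ?G\<^esub> w \<and>
      code_function m u = 2 \<and> code_function m w = 2) \<or>
      (\<exists>u. v \<rightarrow>\<^bsub>with_proj ?G\<^esub> u \<and> code_function m u = 3)"
    by blast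
  \<comment> \<open>A zero in the second row has a zero above it; one in an outer row has a zero beside it,
      in the last column to its left.\<close>
  define u where "u = (if i = 2 then (1, j) else (i, if j = m then j - 1 else j + 1))"
  have "u \<in> pverts ?G" "code_function m u = 0" "v \<rightarrow>\<^bsub>with_proj ?G\<^esub> u"
    using \<open>2 \<le> n\<close> m i j by (auto simp: u_def v pverts_grid code_function_def grid_adj_iff)
  then show "\<exists>u \<in> pverts ?G. code_function m u = 0 \<and> v \<rightarrow>\<^bsub>with_proj ?G\<^esub> u"
    by blast
qed (auto simp: code_function_def split: if_splits)

lemma weight_code_function:
  assumes "n \<ge> 2"
  shows "weight (path_graph n \<boxtimes> path_graph m) (code_function m) = 3 * card (path_code m)"
proof -
  have "{2} \<times> path_code m \<subseteq> {1..n} \<times> {1..m}"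
    using assms by (auto simp: path_code_iff)
  then show ?thesis
    by (simp add: weight_def pverts_grid code_function_def sum.If_cases Int_absorb1
        card_cartesian_product)
qed

theorem theorem3p7:
  fixes n m :: nat
  assumes "n \<in> {2, 3}" and "m \<ge> 2"
  shows "\<gamma>\<^sub>r\<^sub>d\<^sub>R (path_graph n \<boxtimes> path_graph m) =
    (if m mod 3 = 0 then m else if m mod 3 = 1 then m + 2 else m + 1)"
proof -
  let ?G = "path_graph n \<boxtimes> path_graph m"
  have "\<gamma>\<^sub>r\<^sub>d\<^sub>R ?G \<le> 3 * card (path_code m)"
    using gamma_rdR_le[OF rdrd_function_code[OF assms]] weight_code_function[of n m] assms(1)
    by auto
  moreover have "3 * card (path_code m) \<le> \<gamma>\<^sub>r\<^sub>d\<^sub>R ?G"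
    using gamma_rdR_attained[of ?G] rdrd_weight_ge_code[OF assms(1)] by metis
  ultimately show ?thesis
    using card_path_code[of m] by linarith
qed

end
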